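(* Let $n,m\ge 1$ and let $s\in\mathbb{R}^{n\times m}$ be an $n$-channel signal sampled at $m$ times, with rows $\mathbf{u}_1,\dots,\mathbf{u}_n\in\mathbb{R}^{m}$ (row vectors, the channels) and columns $\mathbf{v}_1,\dots,\mathbf{v}_m\in\mathbb{R}^n$. Assume that $s$ is periodic at the time boundaries, i.e. each channel is extended $m$-periodically in time. Assume the angle function $\theta$ of $s$ is well defined and has at least two local extrema, and let $L$ be the double average distance between subsequent extrema of $\theta$. Let $w\in\mathbb{R}^m$ be a filter vector with filter length $L$ obtained as the convolution of a symmetric filter $h$ with itself, let $W\in\mathbb{R}^{m\times m}$ be the associated (circulant) discrete convolution matrix, and let $D$ be the diagonal matrix whose diagonal entries are the eigenvalues of $W$, ordered according to the Fourier basis. For $i=1,\dots,n$ and $k\in\mathbb{N}$ let $\mathbf{u}_i^{(k)}$ be the $k$-th iterate of the moving-average subtraction on channel $i$, i.e. $(\mathbf{u}_i^{(k)})^T=(I-W)^k\mathbf{u}_i^T$. Then for every $\delta>0$ there exists $N_0\in\mathbb{N}$ such that $$\max_{i=1,\dots,n}\big\|\mathbf{u}_i^{(k+1)}-\mathbf{u}_i^{(k)}\big\|_2<\delta\qquad\text{for all }k\ge N_0,$$ and, taking $N_0$ to be the minimum such natural number, the first IMF of $s$ (the $n\times m$ matrix with rows $\mathbf{u}_1^{(N_0)},\dots,\mathbf{u}_n^{(N_0)}$) is given by $$\mathrm{IMF}=\Big[\,\mathrm{iDFT}\big((I-D)^{N_0}\,\mathrm{DFT}(\mathbf{u}_i^T)\big)^T\Big]_{i=1,\dots,n},$$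 that is, its $i$-th row is the transpose of $\mathrm{iDFT}\big((I-D)^{N_0}\,\mathrm{DFT}(\mathbf{u}_i^T)\big)$.
   Context: Indices of vectors in $\mathbb{R}^m$ used as filters run over $0,\dots,m-1$ and are taken modulo $m$. **Angle function and filter length.** For $s=[\mathbf{v}_1\,\mathbf{v}_2\,\dots\,\mathbf{v}_m]$ with nonzero columns, $\theta(t)=\arccos\!\left(\frac{\mathbf{v}_t}{\|\mathbf{v}_t\|}\cdot\frac{\mathbf{v}_{t-1}}{\|\mathbf{v}_{t-1}\|}\right)$ for $t=2,\dots,m$. A local extremum of $\theta$ is an interior index $t$ at which $\theta(t)$ is larger than both neighbouring values or smaller than both. If $t_1<\dots<t_K$ ($K\ge2$) are the local extrema of $\theta$, the double average distance between subsequent extrema is $L=\frac{2}{K-1}\sum_{j=1}^{K-1}(t_{j+1}-t_j)$. **Filters.** A (discrete) symmetric filter is a vector $h\in\mathbb{R}^m$ with $h_j\ge 0$, $h_j=h_{-j}$ for all $j$ (indices mod $m$), and $\sum_{j=0}^{m-1}h_j=1$. The filter vector $w$ is the circular convolution $w=h\ast h$, i.e. $w_j=\sum_{l=0}^{m-1}h_l\,h_{j-l}$ (indices mod $m$). Filter length $L$ means that $L$ is half the support length of the filter: $w_j=0$ whenever $\min(j,m-j)>L$, for $0\le j\le m-1$. **Convolution matrix.** Because of periodic extension, the discrete convolution matrix associated with $w$ is the circulant matrix $W\in\mathbb{R}^{m\times m}$ with entries $W_{jl}=w_{j-l}$ (indices mod $m$). For a column vector $x$, $Wx$ is the moving average of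 $x$, and the iteration repeatedly replaces $x$ by $x-Wx$. **DFT and eigenvalue ordering.** For $x\in\mathbb{C}^m$, $\mathrm{DFT}(x)_p=\sum_{q=0}^{m-1}x_q e^{-2\pi i pq/m}$, $p=0,\dots,m-1$, and $\mathrm{iDFT}$ is the inverse map. The eigenvalues of $W$ are ordered as $\lambda_p=\mathrm{DFT}(w)_p$, $p=0,\dots,m-1$, so $D=\mathrm{diag}(\lambda_0,\dots,\lambda_{m-1})$. **First IMF.** Given $\delta>0$, the first IMF (intrinsic mode function) of $s$ produced by the Multivariate Fast Iterative Filtering algorithm is the $n\times m$ matrix whose $i$-th row is $\mathbf{u}_i^{(N_0)}$, where $N_0$ is the minimum natural number such that $\max_{i}\|\mathbf{u}_i^{(k+1)}-\mathbf{u}_i^{(k)}\|_2<\delta$ for all $k\ge N_0$. *)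

theory Defs
  imports "Jordan_Normal_Form.Char_Poly"
begin

definition l2_norm :: "real vec \<Rightarrow> real" where
  "l2_norm x = sqrt (x \<bullet> x)"

text \<open>Times are numbered \<open>1, \<dots>, m\<close>, so the \<open>t\<close>-th column of \<open>s\<close> is \<open>col s (t - 1)\<close>.
  The function \<open>angle s\<close> is meaningful for \<open>2 \<le> t \<le> m\<close> only.\<close>

definition angle_well_defined :: "real mat \<Rightarrow> bool" where
  "angle_well_defined s \<longleftrightarrow> (\<forall>t<dim_col s. col s t \<noteq> 0\<^sub>v (dim_row s))"

definition normalized :: "real vec \<Rightarrow> real vec" where
  "normalized x = (1 / l2_norm x) \<cdot>\<^sub>v x"

definition angle :: "real mat \<Rightarrow> nat \<Rightarrow> real" where
  "angle s t = arccos (normalized (col s (t - 1)) \<bullet> normalized (col s (t - 2)))"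

definition angle_extrema :: "real mat \<Rightarrow> nat set" where
  "angle_extrema s = {t. 2 < t \<and> t < dim_col s \<and>
     (angle s (t - 1) < angle s t \<and> angle s (t + 1) < angle s t \<or>
      angle s t < angle s (t - 1) \<and> angle s t < angle s (t + 1))}"

definition double_avg_distance :: "nat set \<Rightarrow> real" where
  "double_avg_distance T =
     (let ts = sorted_list_of_set T; K = card T
      in 2 / (real K - 1) * (\<Sum>j<K - 1. real (ts ! (j + 1)) - real (ts ! j)))"

text \<open>Periodic indexing: the index is reduced modulo the length of the vector.\<close>

definition per :: "'a vec \<Rightarrow> int \<Rightarrow> 'a" where
  "per x j = x $ nat (j mod int (dim_vec x))"

definition symmetric_filter :: "nat \<Rightarrow> real vec \<Rightarrow> bool" where
  "symmetric_filter m h \<longleftrightarrow> h \<in> carrier_vec m \<and> (\<forall>j<m. 0 \<le> h $ j) \<and>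
     (\<forall>j. per h j = per h (- j)) \<and> (\<Sum>j<m. h $ j) = 1"

definition circ_conv :: "'a::semiring_0 vec \<Rightarrow> 'a vec \<Rightarrow> 'a vec" where
  "circ_conv x y =
     vec (dim_vec x) (\<lambda>j. \<Sum>l<dim_vec x. x $ l * per y (int j - int l))"

definition has_filter_length :: "real vec \<Rightarrow> real \<Rightarrow> bool" where
  "has_filter_length w L \<longleftrightarrow>
     (\<forall>j<dim_vec w. real (min j (dim_vec w - j)) > L \<longrightarrow> w $ j = 0)"

definition circulant :: "'a vec \<Rightarrow> 'a mat" where
  "circulant w = mat (dim_vec w) (dim_vec w) (\<lambda>(j, l). per w (int j - int l))"

abbreviation complex_vec :: "real vec \<Rightarrow> complex vec" where
  "complex_vec \<equiv> map_vec complex_of_real"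

abbreviation complex_mat :: "real mat \<Rightarrow> complex mat" where
  "complex_mat \<equiv> map_mat complex_of_real"

definition dft :: "complex vec \<Rightarrow> complex vec" where
  "dft x = vec (dim_vec x) (\<lambda>p. \<Sum>q<dim_vec x.
     x $ q * exp (- 2 * of_real pi * \<i> * of_nat p * of_nat q / of_nat (dim_vec x)))"

definition idft :: "complex vec \<Rightarrow> complex vec" where
  "idft y = inv_into (carrier_vec (dim_vec y)) dft y"

definition iterate :: "real mat \<Rightarrow> nat \<Rightarrow> real vec \<Rightarrow> real vec" where
  "iterate W k u = (1\<^sub>m (dim_row W) - W) ^\<^sub>m k *\<^sub>v u"

definition max_increment :: "real mat \<Rightarrow> real mat \<Rightarrow> nat \<Rightarrow> real" where
  "max_increment W s k =
     Max ((\<lambda>i. l2_norm (iterate W (k + 1) (row s i) - iterate W k (row s i))) ` {..<dim_row s})"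

definition stopping_index :: "real mat \<Rightarrow> real mat \<Rightarrow> real \<Rightarrow> nat" where
  "stopping_index W s \<delta> = (LEAST N. \<forall>k\<ge>N. max_increment W s k < \<delta>)"

definition first_imf :: "real mat \<Rightarrow> real mat \<Rightarrow> real \<Rightarrow> real mat" where
  "first_imf W s \<delta> = mat_of_rows (dim_col s)
     (map (\<lambda>i. iterate W (stopping_index W s \<delta>) (row s i)) [0..<dim_row s])"

text \<open>The next facts confirm that \<open>dft\<close> is invertible, and that the entries of \<open>dft w\<close> are the
  eigenvalues of \<open>circulant w\<close>, listed with multiplicity in the order of the Fourier basis.\<close>

definition unity :: "nat \<Rightarrow> int \<Rightarrow> complex" where
  "unity m k = cis (- 2 * pi * of_int k / of_nat m)"

lemma exp_eq_unity:
  "exp (- 2 * of_real pi * \<i> * of_nat p * of_nat q / of_nat m) = unity m (int p * int q)"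
  unfolding unity_def cis_conv_exp by (intro arg_cong[where f = exp]) simp

lemma dft_unity:
  "dft x = vec (dim_vec x) (\<lambda>p. \<Sum>q<dim_vec x. x $ q * unity (dim_vec x) (int p * int q))"
  unfolding dft_def exp_eq_unity ..

lemma unity_add: "unity m (a + b) = unity m a * unity m b"
  unfolding unity_def cis_mult of_int_add distrib_left add_divide_distrib ..

lemma unity_0 [simp]: "unity m 0 = 1"
  by (simp add: unity_def)

lemma unity_mult_m [simp]: "m > 0 \<Longrightarrow> unity m (int m * a) = 1"
proof -
  assume "m > 0"
  then have "unity m (int m * a) = cis (2 * pi * of_int (- a))"
    unfolding unity_def by (intro arg_cong[where f = cis]) (simp add: field_simps)
  then show ?thesis using cis_multiple_2pi[of "of_int (- a)"] by (metis Ints_of_int)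
qed

lemma unity_mod:
  assumes "m > 0"
  shows "unity m (p * (k mod int m)) = unity m (p * k)"
proof -
  have "p * (k mod int m) = p * k + int m * (- p * (k div int m))"
    by (simp add: minus_div_mult_eq_mod[symmetric] right_diff_distrib mult_ac)
  then have "unity m (p * (k mod int m)) = unity m (p * k) * unity m (int m * (- p * (k div int m)))"
    by (simp only: unity_add)
  then show ?thesis
    unfolding unity_mult_m[OF assms] by simp
qed

lemma unity_power: "unity m k ^ q = unity m (k * int q)"
proof (induction q)
  case (Suc q)
  have "k * int (Suc q) = k + k * int q"
    by (simp add: distrib_left)
  then show ?case
    by (simp only: unity_add power_Suc Suc)
qed simp

lemma unity_eq_1: assumes "m > 0" "unity m k = 1" shows "int m dvd k"
proof -
  have "cos (- 2 * pi * real_of_int k / real m) = 1"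
    using assms(2) unfolding unity_def by (metis cis.simps(1) one_complex.simps(1))
  then obtain n :: int where n: "- 2 * pi * real_of_int k / real m = real_of_int n * 2 * pi"
    unfolding cos_one_2pi_int by blast
  then have "pi * - real_of_int k = pi * real_of_int (n * int m)"
    using assms(1) by (simp add: field_simps)
  then have "- real_of_int k = real_of_int (n * int m)"
    by (subst (asm) mult_left_cancel) auto
  then have "- k = n * int m" by linarith
  then have "k = int m * (- n)" by (simp add: mult.commute[of "int m"])
  then show ?thesis by (rule dvdI)
qed

lemma sum_unity:
  assumes "m > 0"
  shows "(\<Sum>q<m. unity m (k * int q)) = (if int m dvd k then of_nat m else 0)"
proof (cases "int m dvd k")
  case True
  then obtain a where "k = int m * a" by blast
  then show ?thesis using assms by (simp add: mult.assoc)
next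
  case False
  then have "unity m k \<noteq> 1" using unity_eq_1[OF assms] by blast
  then have "(\<Sum>q<m. unity m k ^ q) = (unity m k ^ m - 1) / (unity m k - 1)"
    by (rule geometric_sum)
  moreover have "unity m (k * int m) = 1"
    using unity_mult_m[OF assms, of k] by (simp add: mult.commute)
  ultimately show ?thesis using False by (simp add: unity_power)
qed

definition dft_mat :: "nat \<Rightarrow> complex mat" where
  "dft_mat m = mat m m (\<lambda>(p, q). unity m (int p * int q))"

definition idft_mat :: "nat \<Rightarrow> complex mat" where
  "idft_mat m = mat m m (\<lambda>(q, p). unity m (- (int p * int q)) / of_nat m)"

lemma dft_mat_carrier [simp]: "dft_mat m \<in> carrier_mat m m" "idft_mat m \<in> carrier_mat m m"
  by (auto simp: dft_mat_def idft_mat_def)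

lemma dft_carrier [simp]: "x \<in> carrier_vec m \<Longrightarrow> dft x \<in> carrier_vec m"
  by (rule carrier_vecI) (simp add: dft_def)

lemma dft_eq_mult: "x \<in> carrier_vec m \<Longrightarrow> dft x = dft_mat m *\<^sub>v x"
  by (rule eq_vecI)
    (auto simp: dft_unity dft_mat_def scalar_prod_def lessThan_atLeast0 mult.commute intro!: sum.cong)

lemma dft_mat_inverse: "dft_mat m * idft_mat m = 1\<^sub>m m" "idft_mat m * dft_mat m = 1\<^sub>m m"
proof -
  show 1: "dft_mat m * idft_mat m = 1\<^sub>m m"
  proof (rule eq_matI)
    fix i j assume "i < dim_row (1\<^sub>m m :: complex mat)" "j < dim_col (1\<^sub>m m :: complex mat)"
    then have ij: "i < m" "j < m" by auto
    have "(dft_mat m * idft_mat m) $$ (i, j) =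
        (\<Sum>q<m. unity m (int i * int q) * (unity m (- (int j * int q)) / of_nat m))"
      using ij by (simp add: dft_mat_def idft_mat_def scalar_prod_def lessThan_atLeast0)
    also have "\<dots> = (\<Sum>q<m. unity m ((int i - int j) * int q) / of_nat m)"
    proof (rule sum.cong[OF refl])
      fix q
      have "(int i - int j) * int q = int i * int q + - (int j * int q)"
        by (simp add: left_diff_distrib)
      then show "unity m (int i * int q) * (unity m (- (int j * int q)) / of_nat m) =
          unity m ((int i - int j) * int q) / of_nat m"
        by (simp only: unity_add times_divide_eq_right)
    qed
    also have "\<dots> = (\<Sum>q<m. unity m ((int i - int j) * int q)) / of_nat m"
      by (rule sum_divide_distrib[symmetric])
    also have "\<dots> = (if i = j then 1 else 0)"
    proof (cases "i = j")
      case False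
      then have "\<not> int m dvd int i - int j"
        using ij zdvd_imp_le[of "int m" "\<bar>int i - int j\<bar>"] by auto
      then show ?thesis using False ij by (subst sum_unity) auto
    qed (use ij in auto)
    finally show "(dft_mat m * idft_mat m) $$ (i, j) = 1\<^sub>m m $$ (i, j)" using ij by simp
  qed (auto simp: dft_mat_def idft_mat_def)
  show "idft_mat m * dft_mat m = 1\<^sub>m m"
    by (rule mat_mult_left_right_inverse[OF _ _ 1]) auto
qed

lemma bij_betw_dft: "bij_betw dft (carrier_vec m) (carrier_vec m)"
proof (rule bij_betw_byWitness[where f' = "\<lambda>y. idft_mat m *\<^sub>v y"])
  have carr: "idft_mat m *\<^sub>v y \<in> carrier_vec m" if "y \<in> carrier_vec m" for y
    using mult_mat_vec_carrier[OF dft_mat_carrier(2) that] .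
  show "\<forall>x\<in>carrier_vec m. idft_mat m *\<^sub>v dft x = x"
  proof
    fix x :: "complex vec" assume x: "x \<in> carrier_vec m"
    show "idft_mat m *\<^sub>v dft x = x"
      unfolding dft_eq_mult[OF x]
        assoc_mult_mat_vec[OF dft_mat_carrier(2) dft_mat_carrier(1) x, symmetric] dft_mat_inverse
      using x by (rule one_mult_mat_vec)
  qed
  show "\<forall>y\<in>carrier_vec m. dft (idft_mat m *\<^sub>v y) = y"
  proof
    fix y :: "complex vec" assume y: "y \<in> carrier_vec m"
    show "dft (idft_mat m *\<^sub>v y) = y"
      unfolding dft_eq_mult[OF carr[OF y]]
        assoc_mult_mat_vec[OF dft_mat_carrier(1) dft_mat_carrier(2) y, symmetric] dft_mat_inverse
      using y by (rule one_mult_mat_vec)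
  qed
  show "dft ` carrier_vec m \<subseteq> carrier_vec m"
    by (rule image_subsetI) (rule dft_carrier)
  show "(\<lambda>y. idft_mat m *\<^sub>v y) ` carrier_vec m \<subseteq> carrier_vec m"
    by (rule image_subsetI) (rule carr)
qed

lemma idft_dft:
  assumes "x \<in> carrier_vec m"
  shows "idft (dft x) = x"
proof -
  have "dim_vec (dft x) = m" using assms by (simp add: dft_def)
  then show ?thesis
    unfolding idft_def using bij_betw_inv_into_left[OF bij_betw_dft assms] by simp
qed

lemma dft_idft:
  assumes "y \<in> carrier_vec m"
  shows "dft (idft y) = y"
proof -
  have "dim_vec y = m" using assms by simp
  then show ?thesis
    unfolding idft_def using bij_betw_inv_into_right[OF bij_betw_dft assms] by simp
qed

lemma circulant_dft_diagonal:
  assumes w: "w \<in> carrier_vec m"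
  shows "dft_mat m * circulant w = mat_diag m (\<lambda>p. dft w $ p) * dft_mat m"
proof (rule eq_matI)
  fix p l
  assume "p < dim_row (mat_diag m (\<lambda>p. dft w $ p) * dft_mat m)"
    and "l < dim_col (mat_diag m (\<lambda>p. dft w $ p) * dft_mat m)"
  then have pl: "p < m" "l < m" by (auto simp: mat_diag_def dft_mat_def)
  then have m: "m > 0" by simp
  let ?r = "\<lambda>j. nat ((int j - int l) mod int m)"
  have d: "dim_vec w = m" using w by simp
  have reidx: "(\<Sum>j<m. F (?r j)) = (\<Sum>q<m. F q)" for F :: "nat \<Rightarrow> complex"
  proof (rule sum.reindex_bij_witness[of _ "\<lambda>q. nat ((int q + int l) mod int m)" ?r])
    fix a assume "a \<in> {..<m}"
    then show "nat ((int (?r a) + int l) mod int m) = a"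
      using m by (simp add: mod_simps)
  next
    fix a assume "a \<in> {..<m}"
    then show "?r (nat ((int a + int l) mod int m)) = a"
      using m by (simp add: mod_simps)
  qed (use m in \<open>auto simp: nat_less_iff\<close>)
  have "(dft_mat m * circulant w) $$ (p, l) = (\<Sum>j<m. unity m (int p * int j) * w $ ?r j)"
    using pl d by (simp add: dft_mat_def circulant_def per_def scalar_prod_def lessThan_atLeast0)
  also have "\<dots> = (\<Sum>j<m. unity m (int p * int l) * (w $ ?r j * unity m (int p * int (?r j))))"
  proof (rule sum.cong[OF refl])
    fix j
    have "unity m (int p * int (?r j)) = unity m (int p * (int j - int l))"
      using m unity_mod[OF m, of "int p" "int j - int l"] by simp
    moreover have "unity m (int p * int j) = unity m (int p * int l) * unity m (int p * (int j - int l))"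
      by (simp only: unity_add[symmetric]) (simp add: algebra_simps)
    ultimately show "unity m (int p * int j) * w $ ?r j =
        unity m (int p * int l) * (w $ ?r j * unity m (int p * int (?r j)))"
      by (simp only: mult_ac)
  qed
  also have "\<dots> = unity m (int p * int l) * (\<Sum>q<m. w $ q * unity m (int p * int q))"
    unfolding sum_distrib_left[symmetric] reidx[of "\<lambda>q. w $ q * unity m (int p * int q)"] ..
  also have "\<dots> = (mat_diag m (\<lambda>p. dft w $ p) * dft_mat m) $$ (p, l)"
    using pl d
    by (subst mat_diag_mult_left[of _ _ m]) (auto simp: dft_mat_def dft_unity)
  finally show "(dft_mat m * circulant w) $$ (p, l) =
      (mat_diag m (\<lambda>p. dft w $ p) * dft_mat m) $$ (p, l)" .
qed (use w in \<open>auto simp: dft_mat_def circulant_def mat_diag_def\<close>)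

lemma char_poly_circulant:
  assumes w: "w \<in> carrier_vec m"
  shows "char_poly (circulant w) = (\<Prod>p\<leftarrow>[0..<m]. [:- (dft w $ p), 1:])"
proof -
  let ?D = "mat_diag m (\<lambda>p. dft w $ p)" and ?F = "dft_mat m" and ?G = "idft_mat m"
  have W: "circulant w \<in> carrier_mat m m" using w by (simp add: circulant_def)
  have "circulant w = (?G * ?F) * circulant w" using W by (simp add: dft_mat_inverse)
  also have "\<dots> = ?G * (?D * ?F)"
    using W circulant_dft_diagonal[OF w] by (simp add: assoc_mult_mat[of _ m m _ m _ m])
  also have "\<dots> = ?G * ?D * ?F" by (simp add: assoc_mult_mat[of _ m m _ m _ m])
  finally have "similar_mat_wit (circulant w) ?D ?G ?F"
    by (intro similar_mat_witI[of _ _ m]) (use W in \<open>simp_all add: dft_mat_inverse\<close>)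
  then have "char_poly (circulant w) = char_poly ?D"
    by (intro char_poly_similar) (auto simp: similar_mat_def)
  also have "\<dots> = (\<Prod>a\<leftarrow>diag_mat ?D. [:- a, 1:])"
    by (rule char_poly_upper_triangular[of _ m]) (auto simp: mat_diag_def)
  also have "diag_mat ?D = map (\<lambda>p. dft w $ p) [0..<m]"
    by (auto simp: diag_mat_def mat_diag_def)
  finally show ?thesis by (simp add: o_def)
qed

end

theory Submission
  imports Defs
begin

text \<open>The Fourier matrix \<open>F\<close> conjugates the circulant matrix \<open>W\<close> into the diagonal matrix \<open>D\<close>,
  hence \<open>(I - W)\<^sup>k\<close> into \<open>(I - D)\<^sup>k\<close>. So the formula for the IMF holds at every iterate
  (lemma \<open>dft_iterate\<close>), whichever index the stopping rule selects; what needs an argument is that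
  the stopping rule is eventually satisfied.

  In Fourier coordinates the \<open>k\<close>-th increment has the entries \<open>- (1 - \<lambda>\<^sub>p)\<^sup>k \<lambda>\<^sub>p c\<^sub>p\<close>, where
  \<open>c\<^sub>p\<close> are the Fourier coefficients of the channel. They tend to \<open>0\<close> as soon as every eigenvalue
  \<open>\<lambda>\<^sub>p\<close> lies in \<open>[0, 1]\<close>: an eigenvalue \<open>0\<close> contributes nothing, and for the other ones the base
  \<open>1 - \<lambda>\<^sub>p\<close> lies in \<open>[0, 1)\<close>. This is where the shape \<open>w = h * h\<close> of the filter enters (lemma
  \<open>dft_filter_in_unit_interval\<close>). By the convolution theorem \<open>\<lambda>\<^sub>p\<close> is the square of the
  \<open>p\<close>-th Fourier coefficient of \<open>h\<close>. That coefficient is real because \<open>h\<close> is symmetric, so its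
  square is nonnegative; its modulus is at most \<open>1\<close> because \<open>h\<close> is a probability vector. As there
  are finitely many coordinates and channels, coordinatewise convergence gives convergence of the
  maximal norm.\<close>

section \<open>Diagonalisation of the iteration by the Fourier basis\<close>

lemma intertwining_pow_mat:
  fixes A B F :: "'a::semiring_1 mat"
  assumes A: "A \<in> carrier_mat m m" and B: "B \<in> carrier_mat m m" and F: "F \<in> carrier_mat m m"
    and FA: "F * A = B * F"
  shows "F * A ^\<^sub>m k = B ^\<^sub>m k * F"
proof (induction k)
  case 0
  then show ?case using A B F by simp
next
  case (Suc k)
  have Ak: "A ^\<^sub>m k \<in> carrier_mat m m" and Bk: "B ^\<^sub>m k \<in> carrier_mat m m"
    using A B by simp_all
  have "F * A ^\<^sub>m Suc k = (F * A ^\<^sub>m k) * A"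
    using assoc_mult_mat[OF F Ak A] by simp
  also have "\<dots> = B ^\<^sub>m k * (F * A)"
    unfolding Suc by (rule assoc_mult_mat[OF Bk F A])
  also have "\<dots> = B ^\<^sub>m Suc k * F"
    unfolding FA using assoc_mult_mat[OF Bk B F] by simp
  finally show ?case .
qed

lemma pow_mat_diag: "mat_diag m f ^\<^sub>m k = mat_diag m (\<lambda>p. f p ^ k :: 'a::comm_semiring_1)"
proof (induction k)
  case 0
  have "dim_row (mat_diag m f) = m" by (simp add: mat_diag_def)
  then show ?case by simp
next
  case (Suc k)
  then show ?case by (simp add: mat_diag_diag mult.commute)
qed

lemma mat_diag_mult_vec:
  fixes x :: "'a::semiring_0 vec"
  assumes "x \<in> carrier_vec m"
  shows "mat_diag m f *\<^sub>v x = vec m (\<lambda>p. f p * x $ p)"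
proof (rule eq_vecI)
  fix p assume "p < dim_vec (vec m (\<lambda>p. f p * x $ p))"
  then have p: "p < m" by simp
  have "(mat_diag m f *\<^sub>v x) $ p = (\<Sum>q = 0..<m. (if p = q then f q else 0) * x $ q)"
    using p assms by (simp add: mat_diag_def scalar_prod_def)
  also have "\<dots> = (\<Sum>q = 0..<m. if p = q then f q * x $ q else 0)"
    by (intro sum.cong) auto
  finally show "(mat_diag m f *\<^sub>v x) $ p = vec m (\<lambda>p. f p * x $ p) $ p"
    using p by simp
qed (simp add: mat_diag_def)

lemma circulant_carrier [simp]: "w \<in> carrier_vec m \<Longrightarrow> circulant w \<in> carrier_mat m m"
  by (simp add: circulant_def)

lemma per_map_vec: "0 < dim_vec x \<Longrightarrow> per (map_vec f x) j = f (per x j)"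
  by (simp add: per_def nat_less_iff)

lemma complex_mat_circulant: "complex_mat (circulant w) = circulant (complex_vec w)"
  by (rule eq_matI) (auto simp: circulant_def per_map_vec)

lemma dft_circulant_mult:
  assumes w: "w \<in> carrier_vec m" and x: "x \<in> carrier_vec m"
  shows "dft (circulant w *\<^sub>v x) = mat_diag m (\<lambda>p. dft w $ p) *\<^sub>v dft x"
proof -
  have W: "circulant w \<in> carrier_mat m m" using w by simp
  have Wx: "circulant w *\<^sub>v x \<in> carrier_vec m" using W x by simp
  have D: "mat_diag m (\<lambda>p. dft w $ p) \<in> carrier_mat m m" by simp
  show ?thesis
    unfolding dft_eq_mult[OF Wx] dft_eq_mult[OF x]
      assoc_mult_mat_vec[OF dft_mat_carrier(1) W x, symmetric]
      assoc_mult_mat_vec[OF D dft_mat_carrier(1) x, symmetric]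
      circulant_dft_diagonal[OF w] ..
qed

lemma iterate_carrier [simp]:
  assumes "w \<in> carrier_vec m" and "u \<in> carrier_vec m"
  shows "iterate (circulant w) k u \<in> carrier_vec m"
proof -
  have "dim_row (circulant w) = m" using circulant_carrier[OF assms(1)] by blast
  moreover have "1\<^sub>m m - circulant w \<in> carrier_mat m m" using assms by (simp add: minus_carrier_mat)
  ultimately show ?thesis unfolding iterate_def using assms(2)
    by (metis mult_mat_vec_carrier pow_carrier_mat)
qed

text \<open>The Fourier matrix intertwines \<open>I - W\<close> with \<open>I - D\<close>, hence also their powers. The DFT side is
  complex while the iteration is real, so the power of \<open>I - W\<close> is first moved to the complex matrices.\<close>

lemma dft_iterate:
  fixes w u :: "real vec"
  assumes w: "w \<in> carrier_vec m" and u: "u \<in> carrier_vec m"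
  shows "dft (complex_vec (iterate (circulant w) k u)) =
    (1\<^sub>m m - mat_diag m (\<lambda>p. dft (complex_vec w) $ p)) ^\<^sub>m k *\<^sub>v dft (complex_vec u)"
proof -
  let ?F = "dft_mat m" and ?D = "mat_diag m (\<lambda>p. dft (complex_vec w) $ p)"
  let ?W = "circulant (complex_vec w)"
  have cw: "complex_vec w \<in> carrier_vec m" and cu: "complex_vec u \<in> carrier_vec m"
    using w u by simp_all
  have W: "?W \<in> carrier_mat m m" and D: "?D \<in> carrier_mat m m" using cw by simp_all
  have A: "1\<^sub>m m - ?W \<in> carrier_mat m m" and B: "1\<^sub>m m - ?D \<in> carrier_mat m m"
    using W D by (simp_all add: minus_carrier_mat)
  have I: "1\<^sub>m m \<in> carrier_mat m m" by simp
  have "?F * (1\<^sub>m m - ?W) = (1\<^sub>m m - ?D) * ?F"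
    unfolding mult_minus_distrib_mat[OF dft_mat_carrier(1) I W]
      minus_mult_distrib_mat[OF I D dft_mat_carrier(1)] circulant_dft_diagonal[OF cw]
      right_mult_one_mat[OF dft_mat_carrier(1)] left_mult_one_mat[OF dft_mat_carrier(1)] ..
  from intertwining_pow_mat[OF A B dft_mat_carrier(1) this]
  have pow: "?F * (1\<^sub>m m - ?W) ^\<^sub>m k = (1\<^sub>m m - ?D) ^\<^sub>m k * ?F" .
  have Ak: "(1\<^sub>m m - ?W) ^\<^sub>m k \<in> carrier_mat m m" and Bk: "(1\<^sub>m m - ?D) ^\<^sub>m k \<in> carrier_mat m m"
    using A B by simp_all
  have "complex_mat (1\<^sub>m m - circulant w) = 1\<^sub>m m - ?W"
    unfolding complex_mat_circulant[symmetric]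
    by (rule eq_matI) (use w in \<open>auto simp: circulant_def\<close>)
  moreover have "1\<^sub>m m - circulant w \<in> carrier_mat m m"
    using w by (simp add: minus_carrier_mat)
  ultimately have cpow:
    "complex_mat ((1\<^sub>m m - circulant w) ^\<^sub>m k) = (1\<^sub>m m - ?W) ^\<^sub>m k"
    using of_real_hom.mat_hom_pow by metis
  have dimW: "dim_row (circulant w) = m" using w by (simp add: circulant_def)
  have "complex_vec (iterate (circulant w) k u) = (1\<^sub>m m - ?W) ^\<^sub>m k *\<^sub>v complex_vec u"
    unfolding iterate_def dimW cpow[symmetric]
    by (rule of_real_hom.mult_mat_vec_hom[OF pow_carrier_mat u])
      (use w in \<open>simp add: minus_carrier_mat\<close>)
  then show ?thesis
    using dft_eq_mult[OF mult_mat_vec_carrier[OF Ak cu]] dft_eq_mult[OF cu]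
      assoc_mult_mat_vec[OF dft_mat_carrier(1) Ak cu]
      assoc_mult_mat_vec[OF Bk dft_mat_carrier(1) cu] pow
    by simp
qed

lemma dft_iterate_nth:
  fixes w u :: "real vec"
  assumes w: "w \<in> carrier_vec m" and u: "u \<in> carrier_vec m" and p: "p < m"
  shows "dft (complex_vec (iterate (circulant w) k u)) $ p =
    (1 - dft (complex_vec w) $ p) ^ k * dft (complex_vec u) $ p"
proof -
  have "1\<^sub>m m - mat_diag m (\<lambda>p. dft (complex_vec w) $ p) =
      mat_diag m (\<lambda>p. 1 - dft (complex_vec w) $ p)"
    by (rule eq_matI) (auto simp: mat_diag_def)
  moreover have "dft (complex_vec u) \<in> carrier_vec m" using u by simp
  ultimately show ?thesis
    using p by (simp add: dft_iterate[OF w u] pow_mat_diag mat_diag_mult_vec)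
qed

section \<open>The spectrum of a doubly convolved symmetric filter\<close>

text \<open>With this identity the convolution theorem below is a special case of the diagonalisation of
  circulant matrices, and no double sum has to be rearranged.\<close>

lemma circ_conv_eq_circulant_mult:
  fixes x y :: "'a::comm_semiring_0 vec"
  assumes "x \<in> carrier_vec m" and "y \<in> carrier_vec m"
  shows "circ_conv x y = circulant y *\<^sub>v x"
  using assms
  by (intro eq_vecI)
    (auto simp: circ_conv_def circulant_def scalar_prod_def lessThan_atLeast0 mult.commute
      intro!: sum.cong)

lemma complex_vec_circ_conv:
  assumes "x \<in> carrier_vec m" and "y \<in> carrier_vec m"
  shows "complex_vec (circ_conv x y) = circ_conv (complex_vec x) (complex_vec y)"
  using assms by (intro eq_vecI) (auto simp: circ_conv_def per_map_vec)

lemma dft_circ_conv: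
  assumes x: "x \<in> carrier_vec m" and y: "y \<in> carrier_vec m" and p: "p < m"
  shows "dft (circ_conv x y) $ p = dft x $ p * dft y $ p"
proof -
  have "dft x \<in> carrier_vec m" using x by simp
  then show ?thesis
    using p by (simp add: circ_conv_eq_circulant_mult[OF x y] dft_circulant_mult[OF y x]
        mat_diag_mult_vec mult.commute)
qed

lemma cnj_unity: "cnj (unity m k) = unity m (- k)"
  by (simp add: unity_def cis_cnj)

lemma sum_reflect_mod:
  fixes F :: "nat \<Rightarrow> 'a::comm_monoid_add"
  assumes m: "m > 0"
  shows "(\<Sum>q<m. F (nat ((- int q) mod int m))) = (\<Sum>q<m. F q)"
proof -
  let ?r = "\<lambda>q. nat ((- int q) mod int m)"
  have inv: "?r (?r a) = a" if "a < m" for a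
    using m that by (simp add: mod_simps)
  show ?thesis
    by (rule sum.reindex_bij_witness[of _ ?r ?r]) (use m inv in \<open>auto simp: nat_less_iff\<close>)
qed

text \<open>Conjugation replaces the frequency factor at \<open>q\<close> by the one at \<open>- q\<close>, which the symmetry
  of \<open>h\<close> undoes after reflecting the summation index modulo \<open>m\<close>.\<close>

lemma dft_symmetric_filter_real:
  assumes h: "symmetric_filter m h" and p: "p < m"
  shows "dft (complex_vec h) $ p \<in> \<real>"
proof -
  have m: "m > 0" using p by simp
  have d: "dim_vec h = m" and sym: "\<And>j. per h j = per h (- j)"
    using h by (auto simp: symmetric_filter_def)
  let ?r = "\<lambda>q. nat ((- int q) mod int m)"
  have coeff: "dft (complex_vec h) $ p = (\<Sum>q<m. of_real (h $ q) * unity m (int p * int q))"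
    using p d by (simp add: dft_unity)
  have "cnj (dft (complex_vec h) $ p) = (\<Sum>q<m. of_real (h $ q) * unity m (- (int p * int q)))"
    unfolding coeff by (simp add: cnj_unity)
  also have "\<dots> = (\<Sum>q<m. of_real (h $ ?r q) * unity m (int p * int (?r q)))"
  proof (rule sum.cong[OF refl])
    fix q assume "q \<in> {..<m}"
    then have "h $ q = h $ ?r q"
      using sym[of "int q"] d by (simp add: per_def)
    moreover have "unity m (- (int p * int q)) = unity m (int p * int (?r q))"
      using m unity_mod[OF m, of "int p" "- int q"] by simp
    ultimately show "of_real (h $ q) * unity m (- (int p * int q)) =
        of_real (h $ ?r q) * unity m (int p * int (?r q))" by simp
  qed
  also have "\<dots> = dft (complex_vec h) $ p"
    unfolding coeff
    by (rule sum_reflect_mod[OF m, of "\<lambda>q. of_real (h $ q) * unity m (int p * int q)"])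
  finally show ?thesis by (simp add: Reals_cnj_iff)
qed

lemma norm_dft_symmetric_filter_le_1:
  assumes h: "symmetric_filter m h" and p: "p < m"
  shows "norm (dft (complex_vec h) $ p) \<le> 1"
proof -
  have d: "dim_vec h = m" and nonneg: "\<And>j. j < m \<Longrightarrow> 0 \<le> h $ j" and sum1: "(\<Sum>j<m. h $ j) = 1"
    using h by (auto simp: symmetric_filter_def)
  have "norm (dft (complex_vec h) $ p) =
      norm (\<Sum>q<m. of_real (h $ q) * unity m (int p * int q))"
    using p d by (simp add: dft_unity)
  also have "\<dots> \<le> (\<Sum>q<m. norm (of_real (h $ q) * unity m (int p * int q)))"
    by (rule norm_sum)
  also have "\<dots> = (\<Sum>q<m. h $ q)"
    using nonneg by (intro sum.cong) (auto simp: norm_mult unity_def)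
  finally show ?thesis using sum1 by simp
qed

text \<open>A symmetric filter itself may have negative eigenvalues, and \<open>(1 - \<lambda>)\<^sup>k\<close> is unbounded
  for \<open>\<lambda> < 0\<close>. Convolving the filter with itself squares the eigenvalues and so excludes
  this.\<close>

lemma dft_filter_in_unit_interval:
  assumes h: "symmetric_filter m h" and p: "p < m"
  obtains a where "dft (complex_vec (circ_conv h h)) $ p = complex_of_real a" "0 \<le> a" "a \<le> 1"
proof -
  have hc: "h \<in> carrier_vec m" using h by (simp add: symmetric_filter_def)
  then have hc': "complex_vec h \<in> carrier_vec m" by simp
  obtain r where r: "dft (complex_vec h) $ p = complex_of_real r"
    using dft_symmetric_filter_real[OF h p] by (auto elim: Reals_cases)
  have "\<bar>r\<bar> \<le> 1" using norm_dft_symmetric_filter_le_1[OF h p] by (simp add: r)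
  then have "r\<^sup>2 \<le> 1" by (simp add: abs_square_le_1)
  moreover have "dft (complex_vec (circ_conv h h)) $ p = complex_of_real (r\<^sup>2)"
    by (simp add: complex_vec_circ_conv[OF hc hc] dft_circ_conv[OF hc' hc' p] r power2_eq_square)
  ultimately show ?thesis by (intro that[of "r\<^sup>2"]) auto
qed

section \<open>Convergence of the increments\<close>

text \<open>The inverse DFT writes each entry as a fixed linear combination of the Fourier coefficients, so
  convergence passes from the coefficients to the entries, and from there to the norm.\<close>

lemma tendsto_l2_norm_0_if_dft:
  fixes x :: "nat \<Rightarrow> real vec"
  assumes x: "\<And>k. x k \<in> carrier_vec m"
    and lim: "\<And>p. p < m \<Longrightarrow> (\<lambda>k. dft (complex_vec (x k)) $ p) \<longlonglongrightarrow> 0"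
  shows "(\<lambda>k. l2_norm (x k)) \<longlonglongrightarrow> 0"
proof -
  have entry: "(\<lambda>k. x k $ j) \<longlonglongrightarrow> 0" if j: "j < m" for j
  proof -
    have "complex_of_real (x k $ j) =
        (\<Sum>p<m. unity m (- (int p * int j)) / of_nat m * dft (complex_vec (x k)) $ p)" for k
    proof -
      have c: "complex_vec (x k) \<in> carrier_vec m" using x by simp
      then have dc: "dft (complex_vec (x k)) \<in> carrier_vec m" by simp
      have "complex_vec (x k) = idft_mat m *\<^sub>v dft (complex_vec (x k))"
        unfolding dft_eq_mult[OF c]
          assoc_mult_mat_vec[OF dft_mat_carrier(2,1) c, symmetric] dft_mat_inverse
        using c by simp
      moreover have "complex_of_real (x k $ j) = complex_vec (x k) $ j"
        using x[of k] j by simp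
      ultimately have "complex_of_real (x k $ j) = (idft_mat m *\<^sub>v dft (complex_vec (x k))) $ j"
        by simp
      also have "\<dots> = (\<Sum>p<m. unity m (- (int p * int j)) / of_nat m * dft (complex_vec (x k)) $ p)"
        using j carrier_vecD[OF dc] by (simp add: idft_mat_def scalar_prod_def lessThan_atLeast0)
      finally show ?thesis .
    qed
    moreover have "(\<lambda>k. \<Sum>p<m. unity m (- (int p * int j)) / of_nat m
        * dft (complex_vec (x k)) $ p) \<longlonglongrightarrow> 0"
      by (rule tendsto_null_sum) (intro tendsto_mult_right_zero lim, simp)
    ultimately have "(\<lambda>k. complex_of_real (x k $ j)) \<longlonglongrightarrow> of_real 0" by simp
    then show ?thesis by (simp only: tendsto_of_real_iff)
  qed
  have "(\<lambda>k. sqrt (\<Sum>j<m. x k $ j * x k $ j)) \<longlonglongrightarrow> sqrt 0"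
    by (intro tendsto_real_sqrt tendsto_null_sum tendsto_mult_zero) (auto intro: entry)
  moreover have "l2_norm (x k) = sqrt (\<Sum>j<m. x k $ j * x k $ j)" for k
    using x[of k] by (auto simp: l2_norm_def scalar_prod_def lessThan_atLeast0)
  ultimately show ?thesis by simp
qed

text \<open>For \<open>a = 0\<close> the power does not tend to \<open>0\<close>; the factor \<open>a\<close>, which appears because
  increments rather than iterates are measured, then makes the product vanish.\<close>

lemma tendsto_power_times_complement:
  fixes a :: real
  assumes "0 \<le> a" and "a \<le> 1"
  shows "(\<lambda>k. (1 - a) ^ k * a) \<longlonglongrightarrow> 0"
proof (cases "a = 0")
  case False
  then have "(\<lambda>k. (1 - a) ^ k) \<longlonglongrightarrow> 0"
    using assms by (intro LIMSEQ_realpow_zero) auto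
  then show ?thesis by (rule tendsto_mult_left_zero)
qed simp

lemma increment_tendsto_0:
  assumes h: "symmetric_filter m h" and u: "u \<in> carrier_vec m"
  defines "W \<equiv> circulant (circ_conv h h)"
  shows "(\<lambda>k. l2_norm (iterate W (k + 1) u - iterate W k u)) \<longlonglongrightarrow> 0"
proof (rule tendsto_l2_norm_0_if_dft)
  have w: "circ_conv h h \<in> carrier_vec m"
    using h by (auto simp: symmetric_filter_def circ_conv_def)
  have it: "iterate W k u \<in> carrier_vec m" for k
    unfolding W_def using w u by simp
  show "iterate W (k + 1) u - iterate W k u \<in> carrier_vec m" for k
    by (intro minus_carrier_vec it)
  fix p assume p: "p < m"
  obtain a where a: "dft (complex_vec (circ_conv h h)) $ p = complex_of_real a" "0 \<le> a" "a \<le> 1"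
    using dft_filter_in_unit_interval[OF h p] .
  let ?c = "dft (complex_vec u) $ p"
  have "dft (complex_vec (iterate W (k + 1) u - iterate W k u)) $ p =
      complex_of_real ((1 - a) ^ k * a) * - ?c" for k
  proof -
    let ?y = "complex_vec (iterate W (k + 1) u)" and ?z = "complex_vec (iterate W k u)"
    have y: "?y \<in> carrier_vec m" and z: "?z \<in> carrier_vec m"
      using it[of "k + 1"] it[of k] by simp_all
    have split: "complex_vec (iterate W (k + 1) u - iterate W k u) = ?y - ?z"
      using carrier_vecD[OF it[of "k + 1"]] carrier_vecD[OF it[of k]] by (intro eq_vecI) auto
    have "dft (?y - ?z) = dft ?y - dft ?z"
      unfolding dft_eq_mult[OF y] dft_eq_mult[OF z] dft_eq_mult[OF minus_carrier_vec[OF y z]]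
      by (rule mult_minus_distrib_mat_vec[OF dft_mat_carrier(1) y z])
    then have "dft (?y - ?z) $ p = dft ?y $ p - dft ?z $ p"
      using p dft_carrier[OF z] by simp
    also have "\<dots> = (1 - complex_of_real a) ^ (k + 1) * ?c - (1 - complex_of_real a) ^ k * ?c"
      unfolding W_def dft_iterate_nth[OF w u p] a ..
    also have "\<dots> = complex_of_real ((1 - a) ^ k * a) * - ?c"
      by (simp add: algebra_simps)
    finally show ?thesis unfolding split .
  qed
  moreover have "(\<lambda>k. complex_of_real ((1 - a) ^ k * a) * - ?c) \<longlonglongrightarrow> of_real 0 * - ?c"
    by (intro tendsto_mult tendsto_of_real tendsto_power_times_complement a tendsto_const)
  ultimately show "(\<lambda>k. dft (complex_vec (iterate W (k + 1) u - iterate W k u)) $ p) \<longlonglongrightarrow> 0"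
    by simp
qed

theorem theorem1:
  fixes n m :: nat and s :: "real mat" and h w :: "real vec"
    and W :: "real mat" and D :: "complex mat" and L \<delta> :: real
  assumes "n \<ge> 1" and "m \<ge> 1"
    and "s \<in> carrier_mat n m"
    and "angle_well_defined s"
    and "card (angle_extrema s) \<ge> 2"
    and "L = double_avg_distance (angle_extrema s)"
    and "symmetric_filter m h"
    and "w = circ_conv h h"
    and "has_filter_length w L"
    and "W = circulant w"
    and "D = mat_diag m (\<lambda>p. dft (complex_vec w) $ p)"
    and "\<delta> > 0"
  shows "(\<exists>N\<^sub>0. \<forall>k\<ge>N\<^sub>0. max_increment W s k < \<delta>) \<and>
    complex_mat (first_imf W s \<delta>) =
      mat_of_rows m (map (\<lambda>i. idft ((1\<^sub>m m - D) ^\<^sub>m (stopping_index W s \<delta>)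
        *\<^sub>v dft (complex_vec (row s i)))) [0..<n])"
proof
  have s: "s \<in> carrier_mat n m" by fact
  have rows: "row s i \<in> carrier_vec m" for i
    using s by (auto simp: row_def)
  have "\<forall>\<^sub>F k in sequentially. \<forall>i\<in>{..<n}.
      l2_norm (iterate W (k + 1) (row s i) - iterate W k (row s i)) < \<delta>"
  proof (rule eventually_ball_finite, simp, rule ballI)
    fix i
    show "\<forall>\<^sub>F k in sequentially. l2_norm (iterate W (k + 1) (row s i) - iterate W k (row s i)) < \<delta>"
      using order_tendstoD(2)[OF increment_tendsto_0[OF assms(7) rows] \<open>\<delta> > 0\<close>] assms(8,10)
      by simp
  qed
  moreover have "max_increment W s k < \<delta>"
    if "\<forall>i\<in>{..<n}. l2_norm (iterate W (k + 1) (row s i) - iterate W k (row s i)) < \<delta>" for k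
    unfolding max_increment_def using that s \<open>n \<ge> 1\<close>
    by (subst Max_less_iff) (auto simp: lessThan_empty_iff)
  ultimately show "\<exists>N\<^sub>0. \<forall>k\<ge>N\<^sub>0. max_increment W s k < \<delta>"
    unfolding eventually_sequentially by blast
next
  let ?N = "stopping_index W s \<delta>"
  have s: "s \<in> carrier_mat n m" by fact
  have rows: "row s i \<in> carrier_vec m" for i
    using s by (auto simp: row_def)
  have w: "w \<in> carrier_vec m"
    using assms(7,8) by (auto simp: symmetric_filter_def circ_conv_def)
  have it: "iterate W ?N (row s i) \<in> carrier_vec m" for i
    unfolding \<open>W = circulant w\<close> using w rows by (rule iterate_carrier)
  have "idft ((1\<^sub>m m - D) ^\<^sub>m ?N *\<^sub>v dft (complex_vec (row s i))) =
      complex_vec (iterate W ?N (row s i))" for i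
  proof -
    have "complex_vec (iterate W ?N (row s i)) \<in> carrier_vec m" using it by simp
    from idft_dft[OF this] show ?thesis
      using dft_iterate[OF w rows] by (simp add: \<open>W = circulant w\<close> \<open>D = _\<close>)
  qed
  then show "complex_mat (first_imf W s \<delta>) =
      mat_of_rows m (map (\<lambda>i. idft ((1\<^sub>m m - D) ^\<^sub>m ?N *\<^sub>v dft (complex_vec (row s i)))) [0..<n])"
    using s carrier_vecD[OF it] by (intro eq_matI) (auto simp: first_imf_def mat_of_rows_def)
qed

end
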